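(* Let $\ell\ge1$ and let $w=A_{d_1}\cdots A_{d_\ell}$ ($d_1,\dots,d_\ell\ge1$) be a word over the alphabet $\{A_1,A_2,\dots\}$. Then the coefficient of $w$ in $e^{\Omega}$, the formal exact solution operator over one time step of the non-autonomous evolution equation $\partial_t u(t)=A(t)u(t)$ expressed in the Legendre expansion coefficients $A_k$ of $A(t)$, is given by $$\mathrm{coeff}(A_{d_1}\cdots A_{d_\ell},e^{\Omega})=\sum_{\substack{(k_1,\dots,k_\ell)\\ 1\le k_l\le d_l}}\ \prod_{j=1}^{\ell}\frac{(-1)^{d_j+k_j}\binom{d_j-1}{k_j-1}\binom{d_j+k_j-2}{k_j-1}}{\sum_{i=j}^{\ell}k_i}.$$
   Context: Let $P_k(x)=(-1)^k\sum_{j=0}^k\binom{k}{j}\binom{k+j}{j}(-1)^jx^j$ ($k\ge0$) be the Legendre polynomials shifted to $[0,1]$, and for a step-size $\tau>0$ let $\widetilde P_k(t)=\frac1\tau P_k(t/\tau)$. On an interval $[t_n,t_n+\tau]$ the time-dependent matrix $A(t)$ of the evolution equation $\partial_tu(t)=A(t)u(t)$ is expanded as $$A(t_n+t)=A_1\widetilde P_0(t)+A_2\widetilde P_1(t)+A_3\widetilde P_2(t)+\cdots,\qquad t\in[0,\tau].$$ The Legendre coefficients are treated as non-commuting formal variables $A_1,A_2,\dots$, where $A_k$ has grade $k$, and the grade of a word is the sum of the grades of its letters. The exact local solution operator, mapping $u(t_n)$ to $u(t_n+\tau)$, is written as $e^\Omega$, where $\Omega=A_1-\frac16[A_1,A_2]+\cdots$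 is the Magnus series. Formally, $e^{\Omega}$ is the formal power series in the non-commuting variables $A_1,A_2,\dots$ given by $U(\tau)$, where $U(t)$ is the unique solution with values in such formal power series (with coefficients depending on $t$, finitely many words in each grade) of $$U'(t)=\Big(\sum_{k\ge1}\widetilde P_{k-1}(t)A_k\Big)U(t),\qquad U(0)=\mathrm{Id},$$ and $\Omega=\log U(\tau)$. Here the $A_k$ are regarded as constant in $t$, and $\mathrm{Id}$ is the empty word (multiplicative identity). For a word $w$, $\mathrm{coeff}(w,X)$ is the coefficient of $w$ in the formal power series $X$. *)

theory Defs
  imports Complex_Main
begin

text \<open>Real formal power series in the non-commuting variables A_1, A_2, ...:
  the word A_(d1) ... A_(dl) is encoded as the list [d1, ..., dl], and a series is its coefficient
  function. There is no variable A_0, so lists containing 0 get coefficient 0.\<close>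

typedef nc_series = "{f :: nat list \<Rightarrow> real. \<forall>w. 0 \<in> set w \<longrightarrow> f w = 0}"
  morphisms nc_coeff Abs_nc_series
  by (rule exI[of _ "\<lambda>_. 0"]) simp

setup_lifting type_definition_nc_series

lemma nc_series_eqI: "(\<And>w. nc_coeff X w = nc_coeff Y w) \<Longrightarrow> X = Y"
  by (simp add: nc_coeff_inject[symmetric] fun_eq_iff)

lemma nc_coeff_zero_letter: "0 \<in> set w \<Longrightarrow> nc_coeff X w = 0"
  using nc_coeff[of X] by simp

lemma nc_times_closed:
  fixes X Y :: "nat list \<Rightarrow> real"
  assumes "\<And>w. 0 \<in> set w \<Longrightarrow> X w = 0" and "\<And>w. 0 \<in> set w \<Longrightarrow> Y w = 0" and "0 \<in> set w"
  shows "(\<Sum>i\<le>length w. X (take i w) * Y (drop i w)) = 0"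
proof (intro sum.neutral ballI)
  fix i
  have "0 \<in> set (take i w) \<union> set (drop i w)"
    by (metis append_take_drop_id set_append assms(3))
  then show "X (take i w) * Y (drop i w) = 0" using assms(1,2) by auto
qed

instantiation nc_series :: ring_1
begin

lift_definition zero_nc_series :: nc_series is "\<lambda>_. 0" by simp

lift_definition one_nc_series :: nc_series is "\<lambda>w. if w = [] then 1 else 0" by auto

lift_definition plus_nc_series :: "nc_series \<Rightarrow> nc_series \<Rightarrow> nc_series"
  is "\<lambda>X Y w. X w + Y w" by simp

lift_definition minus_nc_series :: "nc_series \<Rightarrow> nc_series \<Rightarrow> nc_series"
  is "\<lambda>X Y w. X w - Y w" by simp

lift_definition uminus_nc_series :: "nc_series \<Rightarrow> nc_series"
  is "\<lambda>X w. - X w" by simp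

lift_definition times_nc_series :: "nc_series \<Rightarrow> nc_series \<Rightarrow> nc_series"
  is "\<lambda>X Y w. \<Sum>i\<le>length w. X (take i w) * Y (drop i w)"
  by (rule nc_times_closed)

instance
proof
  fix a b c :: nc_series
  show "a * b * c = a * (b * c)"
  proof (transfer, rule ext)
    fix a b c :: "nat list \<Rightarrow> real" and w :: "nat list"
    let ?n = "length w"
    let ?f = "\<lambda>j k. a (take j w) * b (take k (drop j w)) * c (drop (j + k) w)"
    have "(\<Sum>i\<le>?n. (\<Sum>j\<le>length (take i w). a (take j (take i w)) * b (drop j (take i w)))
              * c (drop i w)) = (\<Sum>i\<le>?n. \<Sum>j\<le>i. ?f j (i - j))"
      by (intro sum.cong refl)
        (auto simp: sum_distrib_right min_def drop_take intro!: sum.cong)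
    also have "\<dots> = (\<Sum>(j, k)\<in>{(j, k). j + k \<le> ?n}. ?f j k)"
      by (rule sum.triangle_reindex_eq[symmetric])
    also have "{(j, k). j + k \<le> ?n} = (SIGMA j:{..?n}. {..?n - j})"
      by auto
    also have "(\<Sum>(j, k)\<in>(SIGMA j:{..?n}. {..?n - j}). ?f j k) = (\<Sum>j\<le>?n. \<Sum>k\<le>?n - j. ?f j k)"
      by (rule sum.Sigma[symmetric]) auto
    also have "\<dots> = (\<Sum>j\<le>?n. a (take j w) *
        (\<Sum>k\<le>length (drop j w). b (take k (drop j w)) * c (drop k (drop j w))))"
      by (intro sum.cong refl) (auto simp: sum_distrib_left mult.assoc add.commute intro!: sum.cong)
    finally show "(\<Sum>i\<le>?n. (\<Sum>j\<le>length (take i w). a (take j (take i w)) * b (drop j (take i w)))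
              * c (drop i w)) = (\<Sum>j\<le>?n. a (take j w) *
        (\<Sum>k\<le>length (drop j w). b (take k (drop j w)) * c (drop k (drop j w))))" .
  qed
  show "1 * a = a"
  proof (transfer, rule ext)
    fix a :: "nat list \<Rightarrow> real" and w :: "nat list"
    have "(\<Sum>i\<le>length w. (if take i w = [] then 1 else 0) * a (drop i w))
        = (\<Sum>i\<le>length w. if i = 0 then a w else 0)"
      by (intro sum.cong refl) auto
    then show "(\<Sum>i\<le>length w. (if take i w = [] then 1 else 0) * a (drop i w)) = a w" by simp
  qed
  show "a * 1 = a"
  proof (transfer, rule ext)
    fix a :: "nat list \<Rightarrow> real" and w :: "nat list"
    have "(\<Sum>i\<le>length w. a (take i w) * (if drop i w = [] then 1 else 0))
        = (\<Sum>i\<le>length w. if i = length w then a w else 0)"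
      by (intro sum.cong refl) auto
    then show "(\<Sum>i\<le>length w. a (take i w) * (if drop i w = [] then 1 else 0)) = a w" by simp
  qed
  show "(a + b) * c = a * c + b * c"
    by transfer (simp add: fun_eq_iff distrib_right sum.distrib)
  show "a * (b + c) = a * b + a * c"
    by transfer (simp add: fun_eq_iff distrib_left sum.distrib)
  show "(0::nc_series) \<noteq> 1" by transfer (auto simp: fun_eq_iff)
qed (transfer; simp add: fun_eq_iff)+

end

text \<open>Exponential and logarithm are coefficientwise sums of the usual power series. For X with
  constant term 0 in \<open>nc_exp X\<close>, and constant term 1 in \<open>nc_log X\<close>, only the powers up to
  \<open>length w\<close> contribute to the coefficient of w.\<close>

lift_definition nc_exp :: "nc_series \<Rightarrow> nc_series"
  is "\<lambda>X w. \<Sum>n. nc_coeff (X ^ n) w / fact n"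
  by (simp add: nc_coeff_zero_letter)

lift_definition nc_log :: "nc_series \<Rightarrow> nc_series"
  is "\<lambda>X w. \<Sum>n. (-1) ^ n / real (Suc n) * nc_coeff ((X - 1) ^ Suc n) w"
  by (simp add: nc_coeff_zero_letter del: power_Suc)

definition shifted_legendre :: "nat \<Rightarrow> real \<Rightarrow> real" where
  "shifted_legendre k x =
     (-1) ^ k * (\<Sum>j\<le>k. real (k choose j) * real ((k + j) choose j) * (-1) ^ j * x ^ j)"

definition scaled_legendre :: "real \<Rightarrow> nat \<Rightarrow> real \<Rightarrow> real" where
  "scaled_legendre \<tau> k t = (1 / \<tau>) * shifted_legendre k (t / \<tau>)"

text \<open>The series \<open>A(t_n + t) = \<Sum>k\<ge>1. scaled_legendre \<tau> (k - 1) t A_k\<close>, supported on the one-letter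
  words.\<close>

lift_definition legendre_expansion :: "real \<Rightarrow> real \<Rightarrow> nc_series"
  is "\<lambda>\<tau> t w. case w of [k] \<Rightarrow> if k \<ge> 1 then scaled_legendre \<tau> (k - 1) t else 0 | _ \<Rightarrow> 0"
  by (auto split: list.split)

text \<open>\<open>U' = A(t_n + t) U\<close> on \<open>[0, \<tau>]\<close> with \<open>U 0 = Id\<close>; differentiation is coefficientwise
  (one-sided at the endpoints).\<close>

definition is_evolution :: "real \<Rightarrow> (real \<Rightarrow> nc_series) \<Rightarrow> bool" where
  "is_evolution \<tau> U \<longleftrightarrow> U 0 = 1 \<and>
     (\<forall>t\<in>{0..\<tau>}. \<forall>w. ((\<lambda>s. nc_coeff (U s) w) has_real_derivative
        nc_coeff (legendre_expansion \<tau> t * U t) w) (at t within {0..\<tau>}))"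

text \<open>The value \<open>U \<tau>\<close> of the unique solution; the solution itself is only determined on
  \<open>[0, \<tau>]\<close>, hence the description of its end value.\<close>

definition exact_propagator :: "real \<Rightarrow> nc_series" where
  "exact_propagator \<tau> = (THE X. \<exists>U. is_evolution \<tau> U \<and> X = U \<tau>)"

definition magnus_Omega :: "real \<Rightarrow> nc_series" where
  "magnus_Omega \<tau> = nc_log (exact_propagator \<tau>)"

end

theory Submission
  imports Defs "HOL-Analysis.Derivative" "HOL-Computational_Algebra.Formal_Power_Series"
begin

text \<open>The coefficient of \<open>A_d v\<close> in \<open>U\<close> is the integral of a scaled Legendre polynomial times the
  coefficient of \<open>v\<close>. By induction on the word it is a sum of monomials in \<open>t / \<tau>\<close>, indexed by the
  monomials chosen from the Legendre polynomials, and each integration contributes one of the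
  denominators. That \<open>exp (log X) = X\<close> for \<open>X\<close> with constant term 1 is transported from
  univariate power series by substitution of \<open>X - 1\<close>.\<close>

section \<open>Exponential and logarithm\<close>

text \<open>Each of the \<open>n\<close> factors must take at least one letter of \<open>w\<close>,
  since \<open>Y\<close> has no constant term.\<close>

lemma nc_coeff_power_eq_0:
  assumes "nc_coeff Y [] = 0" "length w < n"
  shows "nc_coeff (Y ^ n) w = 0"
  using assms(2)
proof (induction n arbitrary: w)
  case (Suc n)
  have "nc_coeff Y (take i w) * nc_coeff (Y ^ n) (drop i w) = 0" if "i \<le> length w" for i
  proof (cases "i = 0")
    case False
    then show ?thesis using Suc that by simp
  qed (simp add: assms)
  then show ?case by (auto simp: times_nc_series.rep_eq intro!: sum.neutral)
qed simp

text \<open>The substitution \<open>F(Y)\<close> for \<open>Y\<close> with constant term 0; then powers of \<open>Y\<close> beyond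
  \<open>length w\<close> do not contribute to the coefficient of \<open>w\<close>.\<close>

lift_definition fps_subst :: "real fps \<Rightarrow> nc_series \<Rightarrow> nc_series"
  is "\<lambda>F Y w. \<Sum>n\<le>length w. fps_nth F n * nc_coeff (Y ^ n) w"
  by (simp add: nc_coeff_zero_letter)

text \<open>Any truncation from \<open>length w\<close> on gives the same value, so one bound
  \<open>N\<close> can serve all subwords of a word.\<close>

lemma nc_coeff_fps_subst:
  assumes "nc_coeff Y [] = 0" "length w \<le> N"
  shows "nc_coeff (fps_subst F Y) w = (\<Sum>n\<le>N. fps_nth F n * nc_coeff (Y ^ n) w)"
  unfolding fps_subst.rep_eq using assms
  by (intro sum.mono_neutral_left) (auto simp: nc_coeff_power_eq_0)

lemma fps_subst_1: "fps_subst 1 Y = 1"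
proof (rule nc_series_eqI)
  fix w
  have "nc_coeff (fps_subst 1 Y) w = (\<Sum>n\<le>length w. if n = 0 then nc_coeff 1 w else 0)"
    unfolding fps_subst.rep_eq by (intro sum.cong) auto
  then show "nc_coeff (fps_subst 1 Y) w = nc_coeff 1 w" by simp
qed

text \<open>Powers of the single series \<open>Y\<close> multiply as
  \<open>Y ^ a * Y ^ b = Y ^ (a + b)\<close>; collecting the pairs with \<open>a + b = n\<close>
  yields the Cauchy product of \<open>F\<close> and \<open>G\<close>.\<close>

lemma fps_subst_mult:
  assumes Y: "nc_coeff Y [] = 0"
  shows "fps_subst (F * G) Y = fps_subst F Y * fps_subst G Y"
proof (rule nc_series_eqI)
  fix w :: "nat list"
  let ?N = "length w"
  let ?h = "\<lambda>a b. fps_nth F a * fps_nth G b * nc_coeff (Y ^ (a + b)) w"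
  have "nc_coeff (fps_subst F Y * fps_subst G Y) w =
      (\<Sum>i\<le>?N. (\<Sum>a\<le>?N. fps_nth F a * nc_coeff (Y ^ a) (take i w)) *
               (\<Sum>b\<le>?N. fps_nth G b * nc_coeff (Y ^ b) (drop i w)))"
    unfolding times_nc_series.rep_eq
    by (intro sum.cong refl arg_cong2[where f = "(*)"] nc_coeff_fps_subst Y) auto
  also have "\<dots> = (\<Sum>i\<le>?N. \<Sum>a\<le>?N. \<Sum>b\<le>?N. fps_nth F a * fps_nth G b *
      (nc_coeff (Y ^ a) (take i w) * nc_coeff (Y ^ b) (drop i w)))"
    by (simp add: sum_product mult_ac)
  also have "\<dots> = (\<Sum>a\<le>?N. \<Sum>i\<le>?N. \<Sum>b\<le>?N. fps_nth F a * fps_nth G b *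
      (nc_coeff (Y ^ a) (take i w) * nc_coeff (Y ^ b) (drop i w)))"
    by (rule sum.swap)
  also have "\<dots> = (\<Sum>a\<le>?N. \<Sum>b\<le>?N. \<Sum>i\<le>?N. fps_nth F a * fps_nth G b *
      (nc_coeff (Y ^ a) (take i w) * nc_coeff (Y ^ b) (drop i w)))"
    by (rule sum.cong[OF refl], rule sum.swap)
  also have "\<dots> = (\<Sum>a\<le>?N. \<Sum>b\<le>?N. ?h a b)"
    by (simp add: power_add times_nc_series.rep_eq sum_distrib_left)
  also have "\<dots> = (\<Sum>(a, b)\<in>{..?N} \<times> {..?N}. ?h a b)"
    by (rule sum.cartesian_product)
  \<comment> \<open>The square shrinks to a triangle: \<open>Y ^ (a + b)\<close> has no component at
    \<open>w\<close> once \<open>a + b\<close> exceeds its length.\<close>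
  also have "\<dots> = (\<Sum>(a, b)\<in>{(a, b). a + b \<le> ?N}. ?h a b)"
    by (rule sum.mono_neutral_right) (use nc_coeff_power_eq_0[OF Y] in \<open>auto, metis not_le\<close>)
  also have "\<dots> = (\<Sum>n\<le>?N. \<Sum>a\<le>n. ?h a (n - a))"
    by (rule sum.triangle_reindex_eq)
  also have "\<dots> = nc_coeff (fps_subst (F * G) Y) w"
    by (simp add: fps_subst.rep_eq fps_mult_nth sum_distrib_right atMost_atLeast0)
  finally show "nc_coeff (fps_subst (F * G) Y) w = nc_coeff (fps_subst F Y * fps_subst G Y) w" ..
qed

lemma fps_subst_power:
  assumes "nc_coeff Y [] = 0"
  shows "fps_subst (F ^ n) Y = fps_subst F Y ^ n"
  by (induction n) (simp_all add: fps_subst_1 fps_subst_mult assms)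

text \<open>\<open>fps_ln 1\<close> is the series of log(1 + x); its vanishing constant term absorbs
  the index shift in \<open>nc_log\<close>.\<close>

lemma nc_log_eq_fps_subst:
  assumes "nc_coeff X [] = 1"
  shows "nc_log X = fps_subst (fps_ln 1) (X - 1)"
proof (rule nc_series_eqI)
  fix w :: "nat list"
  let ?Y = "X - 1"
  have Y: "nc_coeff ?Y [] = 0"
    by (simp add: minus_nc_series.rep_eq one_nc_series.rep_eq assms)
  have "nc_coeff (nc_log X) w = (\<Sum>n<length w. (-1) ^ n / real (Suc n) * nc_coeff (?Y ^ Suc n) w)"
    unfolding nc_log.rep_eq
    by (rule suminf_finite) (auto simp: nc_coeff_power_eq_0 Y simp del: power_Suc)
  also have "\<dots> = (\<Sum>n<length w. fps_nth (fps_ln 1) (Suc n) * nc_coeff (?Y ^ Suc n) w)"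
    by (simp add: fps_ln_def del: power_Suc)
  also have "\<dots> = (\<Sum>n\<le>length w. fps_nth (fps_ln 1) n * nc_coeff (?Y ^ n) w)"
    by (simp add: sum.atMost_shift fps_ln_def del: power_Suc)
  finally show "nc_coeff (nc_log X) w = nc_coeff (fps_subst (fps_ln 1) ?Y) w"
    by (simp add: fps_subst.rep_eq)
qed

text \<open>\<open>fps_ln 1\<close> is the compositional inverse of
  \<open>fps_exp 1 - 1\<close>.\<close>

lemma fps_exp_compose_ln: "fps_exp (1::real) oo fps_ln 1 = 1 + fps_X"
proof -
  have "(fps_exp (1::real) - 1) oo fps_ln 1 = fps_X"
    by (simp add: fps_ln_fps_exp_inv fps_inv_right)
  then show ?thesis by (simp add: fps_compose_sub_distrib algebra_simps)
qed

text \<open>Expanding the powers of the logarithm in powers of \<open>X - 1\<close> and exchanging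
  the sums leaves the coefficients of \<open>fps_exp 1 oo fps_ln 1\<close>.\<close>

lemma nc_exp_log:
  assumes "nc_coeff X [] = 1"
  shows "nc_exp (nc_log X) = X"
proof (rule nc_series_eqI)
  fix w :: "nat list"
  let ?Y = "X - 1" and ?L = "fps_ln 1 :: real fps" and ?N = "length w"
  have Y: "nc_coeff ?Y [] = 0"
    by (simp add: minus_nc_series.rep_eq one_nc_series.rep_eq assms)
  have coeff: "nc_coeff (nc_log X ^ n) w = (\<Sum>k\<le>?N. fps_nth (?L ^ n) k * nc_coeff (?Y ^ k) w)" for n
    by (simp add: nc_log_eq_fps_subst assms Y fps_subst.rep_eq flip: fps_subst_power)
  \<comment> \<open>\<open>?L\<close> has no constant term, so \<open>?L ^ n\<close> starts in
    degree \<open>n\<close>. This cuts off the exponential series and later lets the composition sum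
    run up to \<open>?N\<close>.\<close>
  have L0: "fps_nth (?L ^ n) k = 0" if "k < n" for n k
    using that by (simp add: startsby_zero_power_prefix)
  have "nc_coeff (nc_exp (nc_log X)) w = (\<Sum>n\<le>?N. nc_coeff (nc_log X ^ n) w / fact n)"
    unfolding nc_exp.rep_eq by (rule suminf_finite) (auto simp: coeff L0)
  also have "\<dots> = (\<Sum>k\<le>?N. \<Sum>n\<le>?N. fps_nth (?L ^ n) k / fact n * nc_coeff (?Y ^ k) w)"
    by (subst sum.swap) (simp add: coeff sum_divide_distrib)
  also have "\<dots> = (\<Sum>k\<le>?N. fps_nth (fps_exp 1 oo ?L) k * nc_coeff (?Y ^ k) w)"
  proof (intro sum.cong refl)
    fix k assume k: "k \<in> {..?N}"
    have "fps_nth (fps_exp 1 oo ?L) k = (\<Sum>n\<le>k. fps_nth (?L ^ n) k / fact n)"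
      by (simp add: fps_compose_nth atMost_atLeast0)
    also have "\<dots> = (\<Sum>n\<le>?N. fps_nth (?L ^ n) k / fact n)"
      using k by (intro sum.mono_neutral_left) (auto simp: L0)
    finally show "(\<Sum>n\<le>?N. fps_nth (?L ^ n) k / fact n * nc_coeff (?Y ^ k) w) =
        fps_nth (fps_exp 1 oo ?L) k * nc_coeff (?Y ^ k) w"
      by (simp add: sum_distrib_right)
  qed
  also have "\<dots> = nc_coeff (fps_subst (1 + fps_X) ?Y) w"
    by (simp add: fps_exp_compose_ln fps_subst.rep_eq)
  \<comment> \<open>With the bound \<open>Suc ?N\<close> the index 1 is in range even for the empty
    word.\<close>
  also have "\<dots> = (\<Sum>k\<le>Suc ?N. fps_nth (1 + fps_X) k * nc_coeff (?Y ^ k) w)"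
    by (rule nc_coeff_fps_subst) (simp_all add: Y)
  also have "\<dots> = (\<Sum>k\<in>{0, 1}. fps_nth (1 + fps_X) k * nc_coeff (?Y ^ k) w)"
    by (rule sum.mono_neutral_right) auto
  also have "\<dots> = nc_coeff X w"
    by (simp add: minus_nc_series.rep_eq)
  finally show "nc_coeff (nc_exp (nc_log X)) w = nc_coeff X w" .
qed

section \<open>The evolution equation\<close>

lemma nc_coeff_legendre_expansion_mult_Nil [simp]:
  "nc_coeff (legendre_expansion \<tau> t * X) [] = 0"
  by (simp add: times_nc_series.rep_eq legendre_expansion.rep_eq)

text \<open>Only the splitting after the first letter survives, because the left factor lives on
  one-letter words.\<close>

lemma nc_coeff_legendre_expansion_mult_Cons:
  "nc_coeff (legendre_expansion \<tau> t * X) (a # w) =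
     (if a \<ge> 1 then scaled_legendre \<tau> (a - 1) t else 0) * nc_coeff X w"
proof -
  have "nc_coeff (legendre_expansion \<tau> t * X) (a # w) =
      (\<Sum>i\<le>Suc (length w). if i = Suc 0 then nc_coeff (legendre_expansion \<tau> t) [a] * nc_coeff X w else 0)"
    unfolding times_nc_series.rep_eq
  proof (intro sum.cong refl)
    fix i assume "i \<in> {..Suc (length w)}"
    then show "nc_coeff (legendre_expansion \<tau> t) (take i (a # w)) * nc_coeff X (drop i (a # w)) =
        (if i = Suc 0 then nc_coeff (legendre_expansion \<tau> t) [a] * nc_coeff X w else 0)"
      by (cases i; cases "i - 1"; cases w) (auto simp: legendre_expansion.rep_eq)
  qed simp
  then show ?thesis by (simp add: legendre_expansion.rep_eq del: sum.atMost_Suc)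
qed

text \<open>The system is triangular: the derivative at \<open>a # w\<close> involves the solution
  only at \<open>w\<close>. By induction the difference of two solutions has derivative 0 and starts
  at 0.\<close>

lemma is_evolution_unique:
  assumes U: "is_evolution \<tau> U" and V: "is_evolution \<tau> V" and t: "t \<in> {0..\<tau>}"
  shows "nc_coeff (U t) w = nc_coeff (V t) w"
  using t
proof (induction w arbitrary: t)
  have der: "((\<lambda>s. nc_coeff (U s) w - nc_coeff (V s) w) has_real_derivative
      nc_coeff (legendre_expansion \<tau> s * U s) w - nc_coeff (legendre_expansion \<tau> s * V s) w)
      (at s within {0..\<tau>})" if "s \<in> {0..\<tau>}" for s w
    using U V that unfolding is_evolution_def by (intro DERIV_diff) auto
  have const: "nc_coeff (U t) w = nc_coeff (V t) w"
    if eq: "\<And>s. s \<in> {0..\<tau>} \<Longrightarrow>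
      nc_coeff (legendre_expansion \<tau> s * U s) w = nc_coeff (legendre_expansion \<tau> s * V s) w"
      and t: "t \<in> {0..\<tau>}" for w t
  proof -
    have "\<exists>c. \<forall>s\<in>{0..\<tau>}. nc_coeff (U s) w - nc_coeff (V s) w = c"
      by (rule has_field_derivative_zero_constant) (use der[of _ w] eq in auto)
    then obtain c where c: "\<And>s. s \<in> {0..\<tau>} \<Longrightarrow> nc_coeff (U s) w - nc_coeff (V s) w = c"
      by blast
    have "U 0 = V 0" using U V by (simp add: is_evolution_def)
    then show ?thesis using c[of 0] c[OF t] t by simp
  qed
  {
    case Nil
    show ?case by (rule const) (use Nil in auto)
  next
    case (Cons a w)
    show ?case
      by (rule const) (use Cons in \<open>auto simp: nc_coeff_legendre_expansion_mult_Cons\<close>)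
  }
qed

section \<open>The explicit solution as polynomials in rescaled time\<close>

definition multi_indices :: "nat list \<Rightarrow> nat list set" where
  "multi_indices d =
     {k. length k = length d \<and> (\<forall>l < length d. 1 \<le> k ! l \<and> k ! l \<le> d ! l)}"

text \<open>For \<open>1 \<le> k \<le> d\<close> this is the coefficient of
  \<open>x ^ (k - 1)\<close> in \<open>shifted_legendre (d - 1) x\<close>.\<close>

definition legendre_coeff :: "nat \<Rightarrow> nat \<Rightarrow> real" where
  "legendre_coeff d k =
     (-1) ^ (d + k) * real ((d - 1) choose (k - 1)) * real ((d + k - 2) choose (k - 1))"

text \<open>Here \<open>k ! j - 1\<close> is the degree of the monomial chosen for letter
  \<open>j\<close>. The last letter is integrated first, so the exponent reached at letter
  \<open>j\<close> is the tail sum from \<open>j\<close> on, which becomes the denominator.\<close>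

definition word_weight :: "nat list \<Rightarrow> nat list \<Rightarrow> real" where
  "word_weight d k =
     (\<Prod>j<length d. legendre_coeff (d ! j) (k ! j) / real (\<Sum>i = j..<length d. k ! i))"

definition word_poly :: "nat list \<Rightarrow> real \<Rightarrow> real" where
  "word_poly d x = (\<Sum>k\<in>multi_indices d. word_weight d k * x ^ sum_list k)"

lemma multi_indices_Nil: "multi_indices [] = {[]}"
  by (auto simp: multi_indices_def)

lemma multi_indices_Cons:
  "multi_indices (a # d) = (\<lambda>(m, k). m # k) ` ({1..a} \<times> multi_indices d)"
proof (rule set_eqI)
  fix k
  show "k \<in> multi_indices (a # d) \<longleftrightarrow> k \<in> (\<lambda>(m, k). m # k) ` ({1..a} \<times> multi_indices d)"
    by (cases k) (auto simp: multi_indices_def image_iff All_less_Suc2)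
qed

lemma word_weight_Cons:
  assumes "length k = length d"
  shows "word_weight (a # d) (m # k) =
    legendre_coeff a m / real (m + sum_list k) * word_weight d k"
proof -
  have "(\<Sum>i = 0..<Suc (length d). (m # k) ! i) = m + sum_list k"
    using sum_list_sum_nth[of "m # k"] assms by simp
  moreover have "(\<Sum>i = Suc j..<Suc (length d). (m # k) ! i) = (\<Sum>i = j..<length d. k ! i)" for j
    by (simp only: sum.shift_bounds_Suc_ivl nth_Cons_Suc)
  ultimately show ?thesis
    unfolding word_weight_def length_Cons prod.lessThan_Suc_shift by (simp only: nth_Cons_0 nth_Cons_Suc o_def)
qed

lemma word_poly_Nil: "word_poly [] x = 1"
  by (simp add: word_poly_def multi_indices_Nil word_weight_def)

text \<open>The outermost integration is isolated: \<open>x ^ n / real n\<close> is the primitive of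
  \<open>x ^ (n - 1)\<close> vanishing at 0.\<close>

lemma word_poly_Cons:
  "word_poly (a # d) x = (\<Sum>m\<in>{1..a}. \<Sum>k\<in>multi_indices d.
     legendre_coeff a m * word_weight d k * (x ^ (m + sum_list k) / real (m + sum_list k)))"
proof -
  have "word_poly (a # d) x = (\<Sum>(m, k)\<in>{1..a} \<times> multi_indices d.
      word_weight (a # d) (m # k) * x ^ sum_list (m # k))"
    unfolding word_poly_def multi_indices_Cons
    by (subst sum.reindex) (auto simp: inj_on_def case_prod_unfold)
  also have "\<dots> = (\<Sum>(m, k)\<in>{1..a} \<times> multi_indices d.
     legendre_coeff a m * word_weight d k * (x ^ (m + sum_list k) / real (m + sum_list k)))"
    by (intro sum.cong refl) (auto simp: word_weight_Cons multi_indices_def)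
  finally show ?thesis by (simp add: sum.cartesian_product)
qed

lemma word_poly_Cons_0: "word_poly (a # d) 0 = 0"
  by (auto simp: word_poly_Cons intro!: sum.neutral)

text \<open>A letter 0 leaves no admissible index; this makes \<open>evolution\<close> a well-formed
  series.\<close>

lemma word_poly_zero_letter: "0 \<in> set d \<Longrightarrow> word_poly d x = 0"
proof -
  assume "0 \<in> set d"
  then have "multi_indices d = {}" by (fastforce simp: multi_indices_def in_set_conv_nth)
  then show ?thesis by (simp add: word_poly_def)
qed

lemma shifted_legendre_eq_sum:
  assumes "a \<ge> 1"
  shows "shifted_legendre (a - 1) x = (\<Sum>m\<in>{1..a}. legendre_coeff a m * x ^ (m - 1))"
proof -
  obtain b where a: "a = Suc b" using assms by (cases a) auto
  have "(\<Sum>m\<in>{1..a}. legendre_coeff a m * x ^ (m - 1)) = (\<Sum>j\<le>b. legendre_coeff a (Suc j) * x ^ j)"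
    unfolding a One_nat_def sum.shift_bounds_cl_Suc_ivl[of _ 0] by (simp add: atMost_atLeast0)
  also have "\<dots> = shifted_legendre b x"
    by (simp add: shifted_legendre_def legendre_coeff_def a sum_distrib_left power_add mult_ac)
  finally show ?thesis by (simp add: a)
qed

text \<open>Differentiation cancels the denominator \<open>m + sum_list k\<close>, and the remaining
  monomial splits into \<open>x ^ (m - 1)\<close> and \<open>x ^ sum_list k\<close>, so the double
  sum factors.\<close>

lemma DERIV_word_poly_Cons:
  "(word_poly (a # d) has_real_derivative
     (if a \<ge> 1 then shifted_legendre (a - 1) x else 0) * word_poly d x) (at x)"
proof -
  have der: "((\<lambda>x. x ^ n / real n) has_real_derivative x ^ (n - 1)) (at x)" if "n \<ge> 1" for n
    using that by (auto intro!: derivative_eq_intros)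
  have "(word_poly (a # d) has_real_derivative (\<Sum>m\<in>{1..a}. \<Sum>k\<in>multi_indices d.
      legendre_coeff a m * word_weight d k * x ^ (m + sum_list k - 1))) (at x)"
    unfolding word_poly_Cons[abs_def]
    by (intro DERIV_sum DERIV_cmult der) auto
  also have "(\<Sum>m\<in>{1..a}. \<Sum>k\<in>multi_indices d.
      legendre_coeff a m * word_weight d k * x ^ (m + sum_list k - 1)) =
      (\<Sum>m\<in>{1..a}. legendre_coeff a m * x ^ (m - 1)) * word_poly d x"
    unfolding sum_product word_poly_def
  proof (intro sum.cong refl)
    fix m k assume "m \<in> {1..a}"
    then have "x ^ (m + sum_list k - 1) = x ^ (m - 1) * x ^ sum_list k"
      by (simp flip: power_add)
    then show "legendre_coeff a m * word_weight d k * x ^ (m + sum_list k - 1) =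
        legendre_coeff a m * x ^ (m - 1) * (word_weight d k * x ^ sum_list k)"
      by simp
  qed
  \<comment> \<open>For \<open>a = 0\<close> the sum over \<open>m\<close> is empty and matches the
    default value 0.\<close>
  also have "\<dots> = (if a \<ge> 1 then shifted_legendre (a - 1) x else 0) * word_poly d x"
    by (cases "a \<ge> 1") (simp_all add: shifted_legendre_eq_sum del: One_nat_def)
  finally show ?thesis .
qed

lift_definition evolution :: "real \<Rightarrow> real \<Rightarrow> nc_series"
  is "\<lambda>\<tau> t w. word_poly w (t / \<tau>)"
  by (rule word_poly_zero_letter)

lemma is_evolution_evolution:
  assumes "\<tau> > 0"
  shows "is_evolution \<tau> (evolution \<tau>)"
  unfolding is_evolution_def
proof (intro conjI ballI allI)
  show "evolution \<tau> 0 = 1"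
  proof (rule nc_series_eqI)
    fix w
    show "nc_coeff (evolution \<tau> 0) w = nc_coeff 1 w"
      by (cases w)
        (simp_all add: evolution.rep_eq one_nc_series.rep_eq word_poly_Nil word_poly_Cons_0)
  qed
  fix t w
  \<comment> \<open>The polynomial formula is differentiable on the whole line, which covers the
    one-sided derivatives at the endpoints. The chain rule supplies the factor
    \<open>1 / \<tau>\<close> of \<open>scaled_legendre\<close>.\<close>
  have "((\<lambda>s. nc_coeff (evolution \<tau> s) w) has_real_derivative
      nc_coeff (legendre_expansion \<tau> t * evolution \<tau> t) w) (at t)"
  proof (cases w)
    case (Cons a d)
    have "((\<lambda>s. word_poly (a # d) (s / \<tau>)) has_real_derivative
        (if a \<ge> 1 then shifted_legendre (a - 1) (t / \<tau>) else 0) * word_poly d (t / \<tau>) * (1 / \<tau>)) (at t)"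
      by (rule DERIV_chain2[OF DERIV_word_poly_Cons DERIV_cdivide[OF DERIV_ident]])
    then show ?thesis
      by (simp add: Cons evolution.rep_eq nc_coeff_legendre_expansion_mult_Cons scaled_legendre_def
          cong: if_cong split: if_splits)
  qed (simp add: evolution.rep_eq word_poly_Nil)
  then show "((\<lambda>s. nc_coeff (evolution \<tau> s) w) has_real_derivative
      nc_coeff (legendre_expansion \<tau> t * evolution \<tau> t) w) (at t within {0..\<tau>})"
    by (rule has_field_derivative_at_within)
qed

lemma exact_propagator_eq:
  assumes "\<tau> > 0"
  shows "exact_propagator \<tau> = evolution \<tau> \<tau>"
  unfolding exact_propagator_def
proof (rule the_equality)
  show "\<exists>U. is_evolution \<tau> U \<and> evolution \<tau> \<tau> = U \<tau>"
    using is_evolution_evolution[OF assms] by blast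
next
  fix X assume "\<exists>U. is_evolution \<tau> U \<and> X = U \<tau>"
  then show "X = evolution \<tau> \<tau>"
    using is_evolution_unique[OF _ is_evolution_evolution[OF assms]] assms
    by (auto intro!: nc_series_eqI)
qed

theorem theorem4p1:
  fixes \<tau> :: real and d :: "nat list"
  assumes "\<tau> > 0"
    and "length d \<ge> 1"
    and "\<forall>i < length d. d ! i \<ge> 1"
  shows "nc_coeff (nc_exp (magnus_Omega \<tau>)) d =
    (\<Sum>k\<in>{k :: nat list. length k = length d \<and> (\<forall>l < length d. 1 \<le> k ! l \<and> k ! l \<le> d ! l)}.
       \<Prod>j<length d.
         ((-1) ^ (d ! j + k ! j) * real ((d ! j - 1) choose (k ! j - 1))
            * real ((d ! j + k ! j - 2) choose (k ! j - 1)))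
         / real (\<Sum>i = j..<length d. k ! i))"
proof -
  \<comment> \<open>Constant term 1 is the condition under which the exponential undoes the
    logarithm.\<close>
  have "nc_coeff (evolution \<tau> \<tau>) [] = 1"
    by (simp add: evolution.rep_eq word_poly_Nil)
  then have "nc_coeff (nc_exp (magnus_Omega \<tau>)) d = word_poly d 1"
    using assms(1) by (simp add: magnus_Omega_def exact_propagator_eq nc_exp_log evolution.rep_eq)
  then show ?thesis
    by (simp add: word_poly_def multi_indices_def word_weight_def legendre_coeff_def)
qed

end
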